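(* Let $(a_0,a_1,\dots)$ be an infinite sequence of nonnegative integers. Then $\lim_{n\to\infty} d(\hat X_n,\hat X_{n+2})=0$.
   Context: Define $C_{-3}=(1,0,0)$, $C_{-2}=(0,1,0)$, $C_{-1}=(0,0,1)$, $C_k=C_{k-3}-C_{k-2}-a_kC_{k-1}$ ($k\ge0$) in $\mathbb{R}^3$, and $X_k=C_k\times C_{k+1}$ ($k\ge-3$). For $V=(a,b,c)$ with $a\ne0$, $\hat V$ is the point $(b/a,c/a)\in\mathbb{R}^2$. $d$ denotes Euclidean distance. *)

theory Defs
  imports "HOL-Analysis.Analysis"
begin

unbundle cross3_syntax

text \<open>The argument is shifted: \<open>C_shift a m\<close> is \<open>C\<^sub>k\<close> for \<open>k = m - 3\<close>.\<close>

fun C_shift :: "(nat \<Rightarrow> nat) \<Rightarrow> nat \<Rightarrow> real ^ 3" where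
  "C_shift a 0 = vector [1, 0, 0]"
| "C_shift a (Suc 0) = vector [0, 1, 0]"
| "C_shift a (Suc (Suc 0)) = vector [0, 0, 1]"
| "C_shift a (Suc (Suc (Suc m))) =
     C_shift a m - C_shift a (Suc m) - real (a m) *\<^sub>R C_shift a (Suc (Suc m))"

text \<open>Only indices \<open>k \<ge> -3\<close> are meaningful; smaller ones give the value at \<open>-3\<close>.\<close>

definition C_vec :: "(nat \<Rightarrow> nat) \<Rightarrow> int \<Rightarrow> real ^ 3" where
  "C_vec a k = C_shift a (nat (k + 3))"

definition X_vec :: "(nat \<Rightarrow> nat) \<Rightarrow> int \<Rightarrow> real ^ 3" where
  "X_vec a k = C_vec a k \<times> C_vec a (k + 1)"

text \<open>Meaningful only for \<open>V $ 1 \<noteq> 0\<close>.\<close>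

definition hat :: "real ^ 3 \<Rightarrow> real ^ 2" where
  "hat V = vector [V $ 2 / V $ 1, V $ 3 / V $ 1]"

lemma C_vec_initial:
  "C_vec a (-3) = vector [1, 0, 0]"
  "C_vec a (-2) = vector [0, 1, 0]"
  "C_vec a (-1) = vector [0, 0, 1]"
  by (simp_all add: C_vec_def numeral_2_eq_2)

lemma C_vec_rec:
  assumes "k \<ge> 0"
  shows "C_vec a k = C_vec a (k - 3) - C_vec a (k - 2) - real (a (nat k)) *\<^sub>R C_vec a (k - 1)"
proof -
  obtain m where k: "k = int m"
    using assms nonneg_int_cases by blast
  have "nat (k + 3) = Suc (Suc (Suc m))" "nat (k - 3 + 3) = m"
    "nat (k - 2 + 3) = Suc m" "nat (k - 1 + 3) = Suc (Suc m)" "nat k = m"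
    using k by auto
  then show ?thesis
    by (simp add: C_vec_def del: diff_add_cancel)
qed

text \<open>The points \<open>hat (X_vec a k)\<close> with \<open>k \<ge> -2\<close> never involve a division by zero.\<close>

lemma X_vec_rec:
  assumes "k \<ge> 0"
  shows "X_vec a k = X_vec a (k - 1) + real (a (nat k)) *\<^sub>R X_vec a (k - 2) + X_vec a (k - 3)"
proof -
  have 1: "C_vec a (k + 1) =
      C_vec a (k - 2) - C_vec a (k - 1) - real (a (nat (k + 1))) *\<^sub>R C_vec a k"
    using C_vec_rec[of "k + 1" a] assms by simp
  note 2 = C_vec_rec[OF assms, of a]
  have X: "X_vec a k = C_vec a k \<times> C_vec a (k + 1)"
    "X_vec a (k - 1) = C_vec a (k - 1) \<times> C_vec a k"
    "X_vec a (k - 2) = C_vec a (k - 2) \<times> C_vec a (k - 1)"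
    "X_vec a (k - 3) = C_vec a (k - 3) \<times> C_vec a (k - 2)"
    by (simp_all add: X_vec_def)
  have "X_vec a k = C_vec a k \<times> C_vec a (k - 2) + X_vec a (k - 1)"
    unfolding X 1 by (simp add: cross3_def vec_eq_iff forall_3 algebra_simps)
  also have "C_vec a k \<times> C_vec a (k - 2) =
      real (a (nat k)) *\<^sub>R X_vec a (k - 2) + X_vec a (k - 3)"
    unfolding X 2 by (simp add: cross3_def vec_eq_iff forall_3 algebra_simps)
  finally show ?thesis
    by simp
qed

lemma X_vec_fst_pos:
  assumes "k \<ge> -2"
  shows "X_vec a k $ 1 > 0"
proof -
  have C0: "C_vec a 0 = vector [1, -1, - real (a 0)]"
    using C_vec_rec[of 0 a] by (simp add: C_vec_initial vec_eq_iff forall_3)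
  have base: "X_vec a (-3) $ 1 = 0" "X_vec a (-2) $ 1 = 1" "X_vec a (-1) $ 1 = 1"
    by (simp_all add: X_vec_def C_vec_initial C0 cross3_def)
  have "X_vec a (int n - 3) $ 1 \<ge> 0 \<and> X_vec a (int n - 2) $ 1 > 0 \<and> X_vec a (int n - 1) $ 1 > 0"
    for n
  proof (induction n)
    case 0
    then show ?case by (simp add: base)
  next
    case (Suc n)
    then show ?case
      using X_vec_rec[of "int n" a] by (simp add: add_pos_nonneg)
  qed
  from this[of "nat (k + 2)"] show ?thesis
    using assms by simp
qed

end

theory Submission
  imports Defs
begin

text \<open>
  Each coordinate of \<open>hat (X_vec a n)\<close> is a real sequence in which every term is a convex
  combination of the three preceding ones, the oldest of which has weight at most \<open>1/2\<close> because
  the denominators increase. The minimum \<open>m\<^sub>n\<close> over three consecutive terms is increasing and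
  bounded, hence convergent. If \<open>p\<close> is the minimum of the two newest terms of a window, the next
  term is at least \<open>(p + m\<^sub>n) / 2\<close>, so that \<open>m\<^sub>n \<le> p \<le> 2 m\<^sub>n\<^sub>+\<^sub>1 - m\<^sub>n\<close>: already the
  minimum over two consecutive terms converges. By symmetry so does the maximum, hence also their
  sum, which is the sum of two consecutive terms; differencing gives the claim.
\<close>

lemma convergent_min_consecutive:
  fixes y \<alpha> \<beta> \<gamma> :: "nat \<Rightarrow> real"
  assumes step: "\<And>n. y (n + 3) = \<alpha> n * y (n + 2) + \<beta> n * y (n + 1) + \<gamma> n * y n"
    and nonneg: "\<And>n. \<alpha> n \<ge> 0" "\<And>n. \<beta> n \<ge> 0" "\<And>n. \<gamma> n \<ge> 0"
    and sum1: "\<And>n. \<alpha> n + \<beta> n + \<gamma> n = 1"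
    and half: "\<And>n. \<gamma> n \<le> 1/2"
  shows "convergent (\<lambda>n. min (y n) (y (n + 1)))"
proof -
  define p where "p n = min (y n) (y (n + 1))" for n
  define m where "m n = min (y n) (p (n + 1))" for n
  have mp: "m n \<le> p (n + 1)" for n
    by (simp add: m_def)
  have step_ge: "y (n + 3) \<ge> (p (n + 1) + m n) / 2" for n
  proof -
    have "1 - \<gamma> n = \<alpha> n + \<beta> n"
      using sum1[of n] by linarith
    then have "(1 - \<gamma> n) * p (n + 1) + \<gamma> n * m n
        = \<alpha> n * p (n + 1) + \<beta> n * p (n + 1) + \<gamma> n * m n"
      by (simp only: distrib_right)
    also have "\<dots> \<le> y (n + 3)"
      unfolding step
      by (intro add_mono mult_left_mono nonneg) (simp_all add: p_def m_def)
    finally have "(1 - \<gamma> n) * p (n + 1) + \<gamma> n * m n \<le> y (n + 3)" .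
    \<comment> \<open>This product is exactly the difference between the weighted mean bounded above
      and \<open>(p (n + 1) + m n) / 2\<close>.\<close>
    moreover have "(1/2 - \<gamma> n) * (p (n + 1) - m n) \<ge> 0"
      using half[of n] mp[of n] by simp
    ultimately show ?thesis
      by (simp add: field_simps)
  qed
  have m_Suc: "m (n + 1) = min (p (n + 1)) (y (n + 3))" for n
    by (simp add: m_def p_def numeral_3_eq_3 min.assoc)
  have m_step: "(p (n + 1) + m n) / 2 \<le> m (n + 1)" for n
    unfolding m_Suc using step_ge[of n] mp[of n] by simp
  have "m n \<le> m (Suc n)" for n
    using m_step[of n] mp[of n] by simp
  then have "incseq m"
    by (rule incseq_SucI)
  \<comment> \<open>Convex combinations never exceed the maximum of the starting values. An upper
    bound suffices, as \<open>m\<close> is increasing.\<close>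
  define K where "K = max (y 0) (max (y 1) (y 2))"
  have bound: "y n \<le> K \<and> y (n + 1) \<le> K \<and> y (n + 2) \<le> K" for n
  proof (induction n)
    case 0
    then show ?case by (auto simp: K_def numeral_2_eq_2)
  next
    case (Suc n)
    have "y (n + 3) \<le> \<alpha> n * K + \<beta> n * K + \<gamma> n * K"
      unfolding step using Suc.IH by (intro add_mono mult_left_mono nonneg) auto
    also have "\<dots> = K"
      using sum1[of n] by (simp flip: distrib_right)
    finally show ?case
      using Suc.IH by (simp add: numeral_3_eq_3)
  qed
  have "m n \<le> K" for n
    using bound[of n] by (simp add: m_def min.coboundedI1)
  then obtain L where L: "m \<longlonglongrightarrow> L"
    using incseq_convergent[OF \<open>incseq m\<close>] by blast
  have "(\<lambda>n. p (n + 1)) \<longlonglongrightarrow> L"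
  proof (rule tendsto_sandwich)
    show "\<forall>\<^sub>F n in sequentially. m n \<le> p (n + 1)"
      using mp by simp
    show "\<forall>\<^sub>F n in sequentially. p (n + 1) \<le> 2 * m (n + 1) - m n"
      using m_step by (intro always_eventually) (simp add: field_simps)
    show "(\<lambda>n. 2 * m (n + 1) - m n) \<longlonglongrightarrow> L"
      using tendsto_diff[OF tendsto_mult_left[OF LIMSEQ_ignore_initial_segment[OF L, of 1], of 2] L]
      by simp
  qed (fact L)
  then have "p \<longlonglongrightarrow> L"
    by (rule LIMSEQ_offset)
  then show ?thesis
    unfolding p_def by (rule convergentI)
qed

text \<open>The recurrence is linear, so \<open>- y\<close> obeys it with the same weights; this
  turns the result on minima into one on maxima.\<close>

lemma convex_recurrence_tendsto:
  fixes y \<alpha> \<beta> \<gamma> :: "nat \<Rightarrow> real"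
  assumes step: "\<And>n. y (n + 3) = \<alpha> n * y (n + 2) + \<beta> n * y (n + 1) + \<gamma> n * y n"
    and weights: "\<And>n. \<alpha> n \<ge> 0" "\<And>n. \<beta> n \<ge> 0" "\<And>n. \<gamma> n \<ge> 0"
      "\<And>n. \<alpha> n + \<beta> n + \<gamma> n = 1" "\<And>n. \<gamma> n \<le> 1/2"
  shows "(\<lambda>n. y n - y (n + 2)) \<longlonglongrightarrow> 0"
proof -
  have "convergent (\<lambda>n. min (y n) (y (n + 1)))"
    by (rule convergent_min_consecutive[OF step weights])
  moreover have "convergent (\<lambda>n. min (- y n) (- y (n + 1)))"
    by (rule convergent_min_consecutive[of "\<lambda>n. - y n", OF _ weights]) (simp add: step)
  ultimately have "convergent (\<lambda>n. min (y n) (y (n + 1)) - min (- y n) (- y (n + 1)))"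
    by (rule convergent_diff)
  also have "(\<lambda>n. min (y n) (y (n + 1)) - min (- y n) (- y (n + 1))) = (\<lambda>n. y n + y (n + 1))"
    by (auto simp: min_def)
  finally obtain L where L: "(\<lambda>n. y n + y (n + 1)) \<longlonglongrightarrow> L"
    by (auto simp: convergent_def)
  \<comment> \<open>The middle term cancels:
    \<open>(y n + y (n + 1)) - (y (n + 1) + y (n + 2))\<close>.\<close>
  from tendsto_diff[OF L LIMSEQ_ignore_initial_segment[OF L, of 1]] show ?thesis
    by (simp add: numeral_2_eq_2)
qed

text \<open>All coordinates of \<open>X_vec\<close> obey one recurrence with nonnegative
  coefficients. Dividing it by the first coordinate \<open>q (n + 3)\<close> makes the coefficients
  of the ratios sum to 1.\<close>

lemma X_vec_ratio_tendsto:
  fixes a :: "nat \<Rightarrow> nat" and j :: 3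
  defines "y \<equiv> \<lambda>n. X_vec a (int n) $ j / X_vec a (int n) $ 1"
  shows "(\<lambda>n. y n - y (n + 2)) \<longlonglongrightarrow> 0"
proof -
  define x where "x n = X_vec a (int n) $ j" for n
  define q where "q n = X_vec a (int n) $ 1" for n
  define b where "b n = real (a (n + 3))" for n
  have y: "y n = x n / q n" for n
    by (simp add: y_def x_def q_def)
  have pos: "q n > 0" for n
    by (simp add: q_def X_vec_fst_pos)
  have rec: "X_vec a (int (n + 3)) =
      X_vec a (int (n + 2)) + b n *\<^sub>R X_vec a (int (n + 1)) + X_vec a (int n)" for n
  proof -
    have "int (n + 3) - 1 = int (n + 2)" "int (n + 3) - 2 = int (n + 1)" "int (n + 3) - 3 = int n"
      by simp_all
    with X_vec_rec[of "int (n + 3)" a] show ?thesis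
      unfolding b_def nat_int by simp
  qed
  have x_rec: "x (n + 3) = x (n + 2) + b n * x (n + 1) + x n"
    and q_rec: "q (n + 3) = q (n + 2) + b n * q (n + 1) + q n" for n
    unfolding x_def q_def rec by simp_all
  \<comment> \<open>The recurrence reaches back to index \<open>n - 2\<close>, so for
    \<open>n = 0\<close> positivity is needed from index -2 on.\<close>
  have "q n \<le> q (Suc n)" for n
    using X_vec_rec[of "int n + 1" a] X_vec_fst_pos[of "int n - 1" a] X_vec_fst_pos[of "int n - 2" a]
    by (simp add: q_def add.commute)
  then have mono: "q n \<le> q (n + 2)" for n
    by (rule lift_Suc_mono_le) simp
  show ?thesis
  proof (rule convex_recurrence_tendsto)
    fix n
    show "y (n + 3) = q (n + 2) / q (n + 3) * y (n + 2) + b n * q (n + 1) / q (n + 3) * y (n + 1)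
        + q n / q (n + 3) * y n"
      using pos[of n] pos[of "n + 1"] pos[of "n + 2"]
      by (simp add: y x_rec add_divide_distrib)
    show "q (n + 2) / q (n + 3) + b n * q (n + 1) / q (n + 3) + q n / q (n + 3) = 1"
      using pos[of "n + 3"] q_rec[of n] by (simp flip: add_divide_distrib)
    have "b n * q (n + 1) \<ge> 0"
      using pos[of "n + 1"] by (simp add: b_def)
    \<comment> \<open>The bound 1/2 comes from
      \<open>q (n + 3) \<ge> q (n + 2) + q n \<ge> 2 * q n\<close>.\<close>
    then show "b n * q (n + 1) / q (n + 3) \<ge> 0" "q n / q (n + 3) \<le> 1/2"
      using pos[of "n + 3"] mono[of n] q_rec[of n] by (simp_all add: field_simps)
  qed (use pos in \<open>simp_all add: less_imp_le\<close>)
qed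

theorem theorem6:
  fixes a :: "nat \<Rightarrow> nat"
  shows "(\<lambda>n::nat. dist (hat (X_vec a (int n))) (hat (X_vec a (int n + 2)))) \<longlonglongrightarrow> 0"
proof -
  have "(\<lambda>n. hat (X_vec a (int n)) - hat (X_vec a (int n + 2))) \<longlonglongrightarrow> 0"
  proof (rule vec_tendstoI)
    fix i :: 2
    show "(\<lambda>n. (hat (X_vec a (int n)) - hat (X_vec a (int n + 2))) $ i) \<longlonglongrightarrow> 0 $ i"
      \<comment> \<open>Components 1 and 2 of \<open>hat\<close> are the ratios with
        \<open>j = 2\<close> and \<open>j = 3\<close>.\<close>
      using X_vec_ratio_tendsto[of a 2] X_vec_ratio_tendsto[of a 3] exhaust_2[of i]
      by (auto simp: hat_def add.commute)
  qed
  then show ?thesis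
    unfolding dist_norm by (rule tendsto_norm_zero)
qed

end
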